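(* Let $\eta$ be a non-periodic Toeplitz sequence with period structure $(p_n)_{n\ge1}$. Assume that for all $k\in\mathbb Z\setminus\{0\}$ and all $\beta\in G$ the set $$\partial W\cap(\partial W-\beta)\cap(\partial W-2\beta-\Delta(k))$$ is nowhere dense with respect to the subspace topology of $\partial W$. Let the automorphism $F$ of $(X_\eta,\sigma)$ be described by a block code $\{0,1\}^{[-m:m]}\to\{0,1\}$. Then $V_k'+(y_F-\Delta(k))\subseteq V_k'$ for all $k\in K$, the set $K$ is contained in $[-m,m]$, and the sets $V_k'$ ($k\in K$) have pairwise disjoint interiors (in $\partial W$).
   Context: A non-periodic Toeplitz sequence with period structure $p_1\mid p_2\mid\dots\to\infty$ is a non-periodic $\eta\in\{0,1\}^{\mathbb Z}$ such that for each $k\in\mathbb Z$ there is $n\ge1$ with $\eta|_{k+p_n\mathbb Z}$ constant. $\sigma$ is the left shift and $X_\eta$ the orbit closure of $\eta$. For $i=0,1$: $\mathcal P_n^i=\{k\in\mathbb Z:\eta|_{k+p_n\mathbb Z}=i\}$. $G=\varprojlim\mathbb Z/p_n\mathbb Z$; $\Delta(k)=(k+p_n\mathbb Z)_n$; $Tg=g+\Delta(1)$; $U_n(h)=\{g\in G:g_n=h_n\}$; $V^i=\bigcup_{n}\bigcup_{k\in\mathcal P_n^i\cap[0,p_n)}U_n(\Delta(k))$; $W=\overline{V^1}=G\setminus V^0$ with boundary $\partial W=G\setminus(V^0\cup V^1)$. Standing assumption: $(G,T)$ is the maximal equicontinuous factor of $(X_\eta,\sigma)$, with factor map $\pi$ determined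 by $\pi(\eta)=\Delta(0)$. An automorphism is a homeomorphism $F$ of $X_\eta$ commuting with $\sigma$; $y_F\in G$ is the unique element with $\pi(F(x))=\pi(x)+y_F$ for all $x\in X_\eta$. $F$ is described by a block code $c:\{0,1\}^{[-m:m]}\to\{0,1\}$ if $(Fx)_s=c(x_{s-m},\dots,x_{s+m})$ for all $x\in X_\eta$, $s\in\mathbb Z$. For $k\in\mathbb Z$: $V_k=\partial W\cap(\partial W+\Delta(k)-y_F)$; $\operatorname{int}_{\partial W}$ is the interior in the subspace topology of $\partial W$; $K=\{k\in\mathbb Z:\operatorname{int}_{\partial W}(V_k)\neq\emptyset\}$; $V_k'=\overline{\operatorname{int}_{\partial W}(V_k)}$. *)

theory Defs
  imports "HOL-Analysis.Analysis" "HOL-Algebra.Product_Groups"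
begin

text \<open>The alphabet \<open>{0,1}\<close> is \<^typ>\<open>bool\<close> (discrete topology), with \<open>True\<close> as \<open>1\<close>; then
  \<open>int \<Rightarrow> bool\<close> carries the product topology. Period structures \<open>p\<close> are indexed by \<open>n \<ge> 1\<close>;
  the value \<open>p 0\<close> is never used.\<close>

section \<open>Toeplitz sequences and their subshifts\<close>

definition nonperiodic_toeplitz :: "(int \<Rightarrow> bool) \<Rightarrow> (nat \<Rightarrow> nat) \<Rightarrow> bool" where
  "nonperiodic_toeplitz \<eta> p \<longleftrightarrow>
     (\<forall>n\<ge>1. p n > 0 \<and> p n dvd p (Suc n)) \<and>
     filterlim p at_top sequentially \<and>
     (\<forall>k. \<exists>n\<ge>1. \<forall>j. \<eta> (k + int (p n) * j) = \<eta> k) \<and>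
     \<not> (\<exists>q>0. \<forall>k. \<eta> (k + q) = \<eta> k)"

definition shift :: "(int \<Rightarrow> bool) \<Rightarrow> (int \<Rightarrow> bool)" where
  "shift x = (\<lambda>s. x (s + 1))"

definition orbit_closure :: "(int \<Rightarrow> bool) \<Rightarrow> (int \<Rightarrow> bool) set" where
  "orbit_closure \<eta> = closure (range (\<lambda>k s. \<eta> (s + k)))"

definition automorphism :: "(int \<Rightarrow> bool) set \<Rightarrow> ((int \<Rightarrow> bool) \<Rightarrow> (int \<Rightarrow> bool)) \<Rightarrow> bool" where
  "automorphism X F \<longleftrightarrow>
     homeomorphic_map (top_of_set X) (top_of_set X) F \<and> (\<forall>x\<in>X. F (shift x) = shift (F x))"

text \<open>A block \<open>x\<^sub>s\<^sub>-\<^sub>m \<dots> x\<^sub>s\<^sub>+\<^sub>m\<close> is passed to the code as an element of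
  \<open>\<Pi>\<^sub>E j\<in>{-m..m}. UNIV\<close>; the values of \<open>c\<close> elsewhere are irrelevant.\<close>

definition described_by_block_code ::
    "(int \<Rightarrow> bool) set \<Rightarrow> ((int \<Rightarrow> bool) \<Rightarrow> (int \<Rightarrow> bool)) \<Rightarrow> nat \<Rightarrow> ((int \<Rightarrow> bool) \<Rightarrow> bool) \<Rightarrow> bool" where
  "described_by_block_code X F m c \<longleftrightarrow>
     (\<forall>x\<in>X. \<forall>s. F x s = c (\<lambda>j\<in>{- int m..int m}. x (s + j)))"

section \<open>The odometer\<close>

text \<open>\<^const>\<open>integer_mod_group\<close> represents residues mod \<open>p n\<close> by \<open>{0..<p n}\<close>. The group is written
  multiplicatively: \<open>\<otimes>\<close> is the addition of \<open>G\<close>, \<open>inv\<close> its negation, and \<open>S #> g\<close> the translate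
  \<open>S + g\<close>.\<close>

definition odometer :: "(nat \<Rightarrow> nat) \<Rightarrow> (nat \<Rightarrow> int) monoid" where
  "odometer p = (product_group {1..} (\<lambda>n. integer_mod_group (p n)))
     \<lparr>carrier := {g \<in> \<Pi>\<^sub>E n\<in>{1..}. carrier (integer_mod_group (p n)).
                   \<forall>n\<ge>1. g (Suc n) mod int (p n) = g n}\<rparr>"

definition odometer_top :: "(nat \<Rightarrow> nat) \<Rightarrow> (nat \<Rightarrow> int) topology" where
  "odometer_top p =
     subtopology (product_topology (\<lambda>n. discrete_topology (carrier (integer_mod_group (p n)))) {1..})
       (carrier (odometer p))"

definition \<Delta> :: "(nat \<Rightarrow> nat) \<Rightarrow> int \<Rightarrow> (nat \<Rightarrow> int)" where
  "\<Delta> p k = (\<lambda>n\<in>{1..}. k mod int (p n))"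

definition odometer_map :: "(nat \<Rightarrow> nat) \<Rightarrow> (nat \<Rightarrow> int) \<Rightarrow> (nat \<Rightarrow> int)" where
  "odometer_map p g = g \<otimes>\<^bsub>odometer p\<^esub> \<Delta> p 1"

definition cylinder :: "(nat \<Rightarrow> nat) \<Rightarrow> nat \<Rightarrow> (nat \<Rightarrow> int) \<Rightarrow> (nat \<Rightarrow> int) set" where
  "cylinder p n h = {g \<in> carrier (odometer p). g n = h n}"

definition Per :: "(nat \<Rightarrow> nat) \<Rightarrow> (int \<Rightarrow> bool) \<Rightarrow> bool \<Rightarrow> nat \<Rightarrow> int set" where
  "Per p \<eta> i n = {k. \<forall>j. \<eta> (k + int (p n) * j) = i}"

definition V :: "(nat \<Rightarrow> nat) \<Rightarrow> (int \<Rightarrow> bool) \<Rightarrow> bool \<Rightarrow> (nat \<Rightarrow> int) set" where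
  "V p \<eta> i = (\<Union>n\<in>{1..}. \<Union>k\<in>Per p \<eta> i n \<inter> {0..<int (p n)}. cylinder p n (\<Delta> p k))"

definition W :: "(nat \<Rightarrow> nat) \<Rightarrow> (int \<Rightarrow> bool) \<Rightarrow> (nat \<Rightarrow> int) set" where
  "W p \<eta> = odometer_top p closure_of V p \<eta> True"

definition bdW :: "(nat \<Rightarrow> nat) \<Rightarrow> (int \<Rightarrow> bool) \<Rightarrow> (nat \<Rightarrow> int) set" where
  "bdW p \<eta> = odometer_top p frontier_of W p \<eta>"

definition bdW_top :: "(nat \<Rightarrow> nat) \<Rightarrow> (int \<Rightarrow> bool) \<Rightarrow> (nat \<Rightarrow> int) topology" where
  "bdW_top p \<eta> = subtopology (odometer_top p) (bdW p \<eta>)"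

definition nowhere_dense_in :: "'a topology \<Rightarrow> 'a set \<Rightarrow> bool" where
  "nowhere_dense_in X S \<longleftrightarrow> X interior_of (X closure_of S) = {}"

section \<open>The maximal equicontinuous factor\<close>

text \<open>Equicontinuity of the \<open>\<int>\<close>-action, with respect to a compatible metric on a compact space
  (the choice of the metric is immaterial by compactness).\<close>

definition equicontinuous_system :: "'a topology \<Rightarrow> ('a \<Rightarrow> 'a) \<Rightarrow> bool" where
  "equicontinuous_system Y R \<longleftrightarrow>
     compact_space Y \<and> homeomorphic_map Y Y R \<and>
     (\<exists>d. Metric_space (topspace Y) d \<and> Metric_space.mtopology (topspace Y) d = Y \<and>
        (\<forall>\<epsilon>>0. \<exists>\<delta>>0. \<forall>x\<in>topspace Y. \<forall>y\<in>topspace Y. d x y < \<delta> \<longrightarrow>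
           (\<forall>n. d ((R ^^ n) x) ((R ^^ n) y) < \<epsilon> \<and>
                d ((inv_into (topspace Y) R ^^ n) x) ((inv_into (topspace Y) R ^^ n) y) < \<epsilon>)))"

definition factor_map ::
    "'a topology \<Rightarrow> ('a \<Rightarrow> 'a) \<Rightarrow> 'b topology \<Rightarrow> ('b \<Rightarrow> 'b) \<Rightarrow> ('a \<Rightarrow> 'b) \<Rightarrow> bool" where
  "factor_map X S Y R \<pi> \<longleftrightarrow>
     continuous_map X Y \<pi> \<and> \<pi> ` topspace X = topspace Y \<and>
     (\<forall>x\<in>topspace X. \<pi> (S x) = R (\<pi> x))"

text \<open>The competing factors \<open>Z\<close> live on the type of \<open>X\<close>. This is no restriction: every factor
  \<open>\<psi>\<close> of \<open>X\<close> is conjugate to one carried by a set of representatives of the fibres of \<open>\<psi>\<close>.\<close>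

definition maximal_equicontinuous_factor ::
    "'a topology \<Rightarrow> ('a \<Rightarrow> 'a) \<Rightarrow> 'b topology \<Rightarrow> ('b \<Rightarrow> 'b) \<Rightarrow> ('a \<Rightarrow> 'b) \<Rightarrow> bool" where
  "maximal_equicontinuous_factor X S Y R \<pi> \<longleftrightarrow>
     equicontinuous_system Y R \<and> factor_map X S Y R \<pi> \<and>
     (\<forall>(Z :: 'a topology) Q \<psi>. equicontinuous_system Z Q \<and> factor_map X S Z Q \<psi> \<longrightarrow>
        (\<exists>\<phi>. factor_map Y R Z Q \<phi> \<and> (\<forall>x\<in>topspace X. \<psi> x = \<phi> (\<pi> x))))"

section \<open>The sets attached to an automorphism\<close>

definition y_of ::
    "(nat \<Rightarrow> nat) \<Rightarrow> (int \<Rightarrow> bool) \<Rightarrow> ((int \<Rightarrow> bool) \<Rightarrow> (nat \<Rightarrow> int)) \<Rightarrow>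
     ((int \<Rightarrow> bool) \<Rightarrow> (int \<Rightarrow> bool)) \<Rightarrow> (nat \<Rightarrow> int)" where
  "y_of p \<eta> \<pi> F = (THE y. y \<in> carrier (odometer p) \<and>
     (\<forall>x\<in>orbit_closure \<eta>. \<pi> (F x) = \<pi> x \<otimes>\<^bsub>odometer p\<^esub> y))"

text \<open>For the following sets the parameter \<open>y\<close> is \<open>y\<^sub>F\<close>.\<close>

definition Vk :: "(nat \<Rightarrow> nat) \<Rightarrow> (int \<Rightarrow> bool) \<Rightarrow> (nat \<Rightarrow> int) \<Rightarrow> int \<Rightarrow> (nat \<Rightarrow> int) set" where
  "Vk p \<eta> y k = bdW p \<eta> \<inter>
     (bdW p \<eta> #>\<^bsub>odometer p\<^esub> (\<Delta> p k \<otimes>\<^bsub>odometer p\<^esub> inv\<^bsub>odometer p\<^esub> y))"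

definition K :: "(nat \<Rightarrow> nat) \<Rightarrow> (int \<Rightarrow> bool) \<Rightarrow> (nat \<Rightarrow> int) \<Rightarrow> int set" where
  "K p \<eta> y = {k. bdW_top p \<eta> interior_of Vk p \<eta> y k \<noteq> {}}"

definition Vk' :: "(nat \<Rightarrow> nat) \<Rightarrow> (int \<Rightarrow> bool) \<Rightarrow> (nat \<Rightarrow> int) \<Rightarrow> int \<Rightarrow> (nat \<Rightarrow> int) set" where
  "Vk' p \<eta> y k = odometer_top p closure_of (bdW_top p \<eta> interior_of Vk p \<eta> y k)"

end

theory Submission
  imports Defs
begin

text \<open>A point \<open>g\<close> lies in \<open>\<partial>W\<close> iff its fibre contains two sequences that differ at position \<open>0\<close>.
  Hence the block code of \<open>F\<close> and surjectivity give, for every \<open>g \<in> \<partial>W\<close>, some \<open>\<bar>j\<bar> \<le> m\<close> with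
  \<open>g - b\<^sub>j \<in> \<partial>W\<close>, where \<open>b\<^sub>k = y\<^sub>F - \<Delta>(k)\<close>; injectivity and compactness show that finitely many
  of the sets \<open>V\<^sub>k = {g \<in> \<partial>W. g + b\<^sub>k \<in> \<partial>W}\<close>, and therefore of the sets \<open>V'\<^sub>k\<close>, cover \<open>\<partial>W\<close>.
  By hypothesis \<open>g\<close>, \<open>g + b\<^sub>k\<close>, \<open>g + b\<^sub>k + b\<^sub>l\<close> with \<open>l \<noteq> k\<close> cannot all lie in \<open>\<partial>W\<close> for \<open>g\<close> in a
  nonempty open set, and likewise with \<open>- b\<^sub>k\<close>, \<open>- b\<^sub>l\<close>. So generically the point
  \<open>g + b\<^sub>k\<close>, for \<open>g \<in> int V\<^sub>k\<close>, is covered by \<open>V'\<^sub>k\<close> itself, which gives \<open>V'\<^sub>k + b\<^sub>k \<subseteq> V'\<^sub>k\<close>, and by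
  recurrence of translations also \<open>V'\<^sub>k - b\<^sub>k \<subseteq> V'\<^sub>k\<close>. Going backwards once more from
  \<open>g - b\<^sub>k \<in> V'\<^sub>k\<close> then forces \<open>\<bar>k\<bar> \<le> m\<close>, and excludes overlaps of \<open>V'\<^sub>k\<close> and \<open>V'\<^sub>j\<close>.\<close>

section \<open>Overlaps of translates of a closed set\<close>

text \<open>A finite form of Baire's theorem, valid in every space: if \<open>U\<close> is not
  inside \<open>C a\<close>, then \<open>U - C a\<close> is nonempty, open and covered by the
  remaining sets. It replaces an index depending on the point by one index on a whole open
  set.\<close>

lemma openin_subset_finite_UN_closedin:
  assumes "finite L" "openin X U" "U \<noteq> {}" "U \<subseteq> (\<Union>l\<in>L. C l)" "\<And>l. l \<in> L \<Longrightarrow> closedin X (C l)"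
  obtains l U' where "l \<in> L" "openin X U'" "U' \<noteq> {}" "U' \<subseteq> U" "U' \<subseteq> C l"
  using assms
proof (induction L arbitrary: U thesis rule: finite_induct)
  case empty
  then show ?case by simp
next
  case (insert a L)
  show ?case
  proof (cases "U \<subseteq> C a")
    case True
    with insert.prems show ?thesis by blast
  next
    case False
    have "openin X (U - C a)"
      using insert.prems by (simp add: openin_diff)
    moreover have "U - C a \<noteq> {}" "U - C a \<subseteq> (\<Union>l\<in>L. C l)"
      using False insert.prems by auto
    ultimately obtain l U' where "l \<in> L" "openin X U'" "U' \<noteq> {}" "U' \<subseteq> U - C a" "U' \<subseteq> C l"
      using insert.IH[of "U - C a"] insert.prems(5) by (metis insertCI)
    then show ?thesis
      using insert.prems(1)[of l U'] by blast
  qed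
qed

lemma (in group) mem_r_coset_iff:
  assumes "H \<subseteq> carrier G" "a \<in> carrier G" "x \<in> carrier G"
  shows "x \<in> H #> a \<longleftrightarrow> x \<otimes> inv a \<in> H"
proof
  assume "x \<in> H #> a"
  then obtain h where "h \<in> H" "x = h \<otimes> a"
    by (auto simp: r_coset_def)
  with assms show "x \<otimes> inv a \<in> H"
    by (metis in_mono inv_solve_right)
next
  assume "x \<otimes> inv a \<in> H"
  moreover have "x = x \<otimes> inv a \<otimes> a"
    using assms by (simp add: m_assoc)
  ultimately show "x \<in> H #> a"
    by (auto simp: r_coset_def)
qed

text \<open>In a compact group the assumption \<open>recurrent\<close> is automatic, because there every
  closed subsemigroup is a subgroup.\<close>

locale overlap_setup = comm_group G for G (structure) +
  fixes T :: "'a topology" and B :: "'a set" and D :: "int \<Rightarrow> 'a" and y :: 'a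
  assumes topspace_T: "topspace T = carrier G"
    and continuous_translation: "a \<in> carrier G \<Longrightarrow> continuous_map T T (\<lambda>x. x \<otimes> a)"
    and recurrent: "\<lbrakk>closedin T S; a \<in> carrier G; \<And>x. x \<in> S \<Longrightarrow> x \<otimes> a \<in> S; x \<in> S\<rbrakk> \<Longrightarrow> x \<otimes> inv a \<in> S"
    and closedin_B: "closedin T B"
    and D_closed: "D k \<in> carrier G"
    and D_diff: "D (k - l) = D k \<otimes> inv D l"
    and y_closed: "y \<in> carrier G"
    and nowhere_dense_overlap: "\<And>k \<beta>. k \<noteq> 0 \<Longrightarrow> \<beta> \<in> carrier G \<Longrightarrow>
      nowhere_dense_in (subtopology T B)
        (B \<inter> (B #> inv \<beta>) \<inter> (B #> (inv (\<beta> \<otimes> \<beta>) \<otimes> inv D k)))"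
    and ex_finite_forward: "\<exists>L. finite L \<and> (\<forall>x\<in>B. \<exists>l\<in>L. x \<otimes> (y \<otimes> inv D l) \<in> B)"
begin

abbreviation "X \<equiv> subtopology T B"

section \<open>The translations \<open>b k\<close> and the sets \<open>VV k\<close>,
  \<open>VV' k\<close>\<close>

definition b :: "int \<Rightarrow> 'a" where "b k = y \<otimes> inv D k"
text \<open>The abstract forms of \<open>Vk\<close> and \<open>Vk'\<close>, with the same right-hand
  sides so that unfolding identifies them.\<close>

definition VV :: "int \<Rightarrow> 'a set" where "VV k = B \<inter> (B #> (D k \<otimes> inv y))"
definition VV' :: "int \<Rightarrow> 'a set" where "VV' k = T closure_of (X interior_of VV k)"

lemma b_closed: "b k \<in> carrier G"
  by (simp add: b_def D_closed y_closed)

lemma B_subset: "B \<subseteq> carrier G"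
  using closedin_B closedin_subset topspace_T by blast

lemma inv_b: "inv (b k) = D k \<otimes> inv y"
  by (simp add: b_def D_closed y_closed inv_mult_group)

text \<open>With \<beta> = \<open>b k\<close>, going on by \<beta> and \<open>D (k - l)\<close> is a
  step by \<open>b l\<close>. This brings two successive steps \<open>b k\<close>,
  \<open>b l\<close> into the shape of the overlap hypothesis.\<close>

lemma b_diff: "b k \<otimes> D (k - l) = b l"
proof -
  have "b k \<otimes> D (k - l) = y \<otimes> (inv D k \<otimes> (D k \<otimes> inv D l))"
    by (simp add: b_def D_closed D_diff y_closed m_assoc)
  also have "inv D k \<otimes> (D k \<otimes> inv D l) = inv D l"
    using D_closed by (simp flip: m_assoc)
  finally show ?thesis by (simp only: b_def)
qed

text \<open>The counterpart for backward steps, with \<beta> = \<open>inv (b k)\<close>; the index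
  difference changes sign.\<close>

lemma inv_b_diff: "inv (b k) \<otimes> D (l - k) = inv (b l)"
proof -
  have "inv (b k) \<otimes> D (l - k) = D k \<otimes> inv y \<otimes> (D l \<otimes> inv D k)"
    by (simp add: inv_b D_diff)
  also have "\<dots> = (D k \<otimes> inv D k) \<otimes> (D l \<otimes> inv y)"
    using D_closed y_closed by (simp only: m_ac inv_closed m_closed)
  also have "\<dots> = inv (b l)"
    by (simp add: inv_b D_closed y_closed)
  finally show ?thesis .
qed

lemma mem_VV: "x \<in> VV k \<longleftrightarrow> x \<in> B \<and> x \<otimes> b k \<in> B"
proof (cases "x \<in> B")
  case True
  then have "x \<in> B #> inv (b k) \<longleftrightarrow> x \<otimes> b k \<in> B"
    using mem_r_coset_iff[OF B_subset inv_closed[OF b_closed], of x] B_subset b_closed by auto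
  with True show ?thesis by (simp add: VV_def inv_b)
qed (simp add: VV_def)

lemma closedin_translate_preimage:
  assumes "closedin T S" "a \<in> carrier G"
  shows "closedin T {x \<in> carrier G. x \<otimes> a \<in> S}"
  using closedin_continuous_map_preimage[OF continuous_translation[OF assms(2)] assms(1)]
  by (simp add: topspace_T)

lemma openin_translate_preimage:
  assumes "openin T S" "a \<in> carrier G"
  shows "openin T {x \<in> carrier G. x \<otimes> a \<in> S}"
  using openin_continuous_map_preimage[OF continuous_translation[OF assms(2)] assms(1)]
  by (simp add: topspace_T)

lemma closedin_X_translate_preimage:
  assumes "closedin T S" "a \<in> carrier G"
  shows "closedin X {x \<in> B. x \<otimes> a \<in> S}"
proof -
  have "{x \<in> B. x \<otimes> a \<in> S} = B \<inter> {x \<in> carrier G. x \<otimes> a \<in> S}"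
    using B_subset by auto
  then show ?thesis
    using closedin_translate_preimage[OF assms] by (simp add: closedin_subtopology_Int_closed)
qed

lemma closedin_VV: "closedin T (VV k)"
proof -
  have "VV k = B \<inter> {x \<in> carrier G. x \<otimes> b k \<in> B}"
    using mem_VV B_subset by blast
  then show ?thesis
    using closedin_B closedin_translate_preimage[OF closedin_B b_closed] by (simp only: closedin_Int)
qed

lemma closedin_VV': "closedin T (VV' k)"
  by (simp add: VV'_def)

lemma VV'_subset: "VV' k \<subseteq> VV k"
  unfolding VV'_def using closure_of_minimal[OF interior_of_subset closedin_VV] .

lemma mem_VV'D: assumes "x \<in> VV' k" shows "x \<in> B" "x \<in> carrier G" "x \<otimes> b k \<in> B"
  using assms VV'_subset[of k] mem_VV[of x k] B_subset by blast+

lemma interior_subset_VV': "X interior_of VV k \<subseteq> VV' k"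
  unfolding VV'_def
proof (rule closure_of_subset)
  show "X interior_of VV k \<subseteq> topspace T"
    using interior_of_subset_topspace[of X "VV k"] B_subset topspace_T by auto
qed

text \<open>Such a \<open>U\<close> would lie in the overlap set, hence in the interior of its
  closure. The second translate is written as two steps so that \<open>b_diff\<close> and
  \<open>inv_b_diff\<close> rewrite it directly.\<close>

lemma no_open_overlap:
  assumes "openin X U" "U \<noteq> {}" "k \<noteq> 0" "\<beta> \<in> carrier G"
    and "\<And>x. x \<in> U \<Longrightarrow> x \<otimes> \<beta> \<in> B" "\<And>x. x \<in> U \<Longrightarrow> x \<otimes> \<beta> \<otimes> (\<beta> \<otimes> D k) \<in> B"
  shows False
proof -
  let ?S = "B \<inter> (B #> inv \<beta>) \<inter> (B #> (inv (\<beta> \<otimes> \<beta>) \<otimes> inv D k))"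
  have UB: "U \<subseteq> B"
    using assms(1) openin_subset by fastforce
  have "U \<subseteq> ?S"
  proof
    fix x assume x: "x \<in> U"
    then have xB: "x \<in> B" "x \<in> carrier G"
      using UB B_subset by auto
    have "inv (\<beta> \<otimes> \<beta>) \<otimes> inv D k = inv (\<beta> \<otimes> (\<beta> \<otimes> D k))"
      using assms(4) D_closed by (simp add: inv_mult m_ac)
    moreover have "x \<otimes> (\<beta> \<otimes> (\<beta> \<otimes> D k)) \<in> B"
      using assms(4) assms(6)[OF x] xB(2) D_closed by (simp add: m_assoc)
    ultimately show "x \<in> ?S"
      using xB assms(4) assms(5)[OF x] D_closed
      by (auto simp: mem_r_coset_iff[OF B_subset])
  qed
  then have "U \<subseteq> X interior_of (X closure_of ?S)"
    using assms(1) by (meson Int_lower1 closure_of_subset interior_of_maximal le_infI1 order_trans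
        topspace_subtopology_subset[THEN equalityD2] B_subset topspace_T[THEN equalityD2])
  then show False
    using nowhere_dense_overlap[OF assms(3,4)] assms(2) by (auto simp: nowhere_dense_in_def)
qed

text \<open>The points of \<open>B\<close> missed by these \<open>VV' l\<close> form a relatively
  open set covered by finitely many closed \<open>VV l\<close>. If nonempty, it would contain a
  nonempty open piece inside one \<open>VV l\<close>, hence inside its interior and inside
  \<open>VV' l\<close>.\<close>

lemma VV'_cover: "\<exists>L. finite L \<and> B \<subseteq> (\<Union>l\<in>L. VV' l)"
proof -
  obtain L where L: "finite L" "\<And>x. x \<in> B \<Longrightarrow> \<exists>l\<in>L. x \<otimes> b l \<in> B"
    using ex_finite_forward unfolding b_def by blast
  have "B - (\<Union>l\<in>L. VV' l) = {}"
  proof (rule ccontr)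
    let ?U = "B - (\<Union>l\<in>L. VV' l)"
    assume ne: "?U \<noteq> {}"
    have "closedin T (\<Union>(VV' ` L))"
      using L(1) closedin_VV' by (intro closedin_Union) auto
    then have "openin T (topspace T - (\<Union>l\<in>L. VV' l))"
      by blast
    then have "openin X (B \<inter> (topspace T - (\<Union>l\<in>L. VV' l)))"
      by (rule openin_subtopology_Int2)
    moreover have "B \<inter> (topspace T - (\<Union>l\<in>L. VV' l)) = ?U"
      using B_subset topspace_T by auto
    ultimately have op: "openin X ?U" by simp
    have sub: "?U \<subseteq> (\<Union>l\<in>L. VV l)"
      using L(2) mem_VV by blast
    have cl: "closedin X (VV l)" for l
      using closedin_VV[of l] by (rule closedin_subset_topspace) (simp add: VV_def)
    obtain l U' where "l \<in> L" "openin X U'" "U' \<noteq> {}" "U' \<subseteq> ?U" "U' \<subseteq> VV l"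
      using openin_subset_finite_UN_closedin[OF L(1) op ne sub cl] .
    moreover from this have "U' \<subseteq> VV' l"
      using interior_subset_VV'[of l] interior_of_maximal[of U' "VV l" X] by blast
    ultimately show False by blast
  qed
  with L(1) show ?thesis by blast
qed

text \<open>For x in the interior of \<open>VV k\<close>, the point x + b_k is in \<open>B\<close>,
  hence in some \<open>VV' l\<close> of the cover. If \<open>VV' k\<close> were left, one index l
  different from k would serve on an open set, and x, x + b_k, x + b_k + b_l would all lie in
  \<open>B\<close> there.\<close>

lemma VV'_translate:
  assumes "x \<in> VV' k"
  shows "x \<otimes> b k \<in> VV' k"
proof -
  let ?I = "X interior_of VV k"
  obtain L where L: "finite L" "B \<subseteq> (\<Union>l\<in>L. VV' l)"
    using VV'_cover by blast
  have I: "?I \<subseteq> VV k"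
    by (rule interior_of_subset)
  have "{x \<in> ?I. x \<otimes> b k \<notin> VV' k} = {}"
  proof (rule ccontr)
    let ?U = "{x \<in> ?I. x \<otimes> b k \<notin> VV' k}"
    assume ne: "?U \<noteq> {}"
    have "?U = ?I - {x \<in> B. x \<otimes> b k \<in> VV' k}"
      using I by (auto simp: VV_def)
    then have op: "openin X ?U"
      using openin_diff[OF openin_interior_of
          closedin_X_translate_preimage[OF closedin_VV' b_closed]] by (simp only:)
    have "x \<in> (\<Union>l\<in>L. {x \<in> B. x \<otimes> b k \<in> VV' l})" if "x \<in> ?U" for x
      using that I L(2) mem_VV[of x k] by blast
    then have sub: "?U \<subseteq> (\<Union>l\<in>L. {x \<in> B. x \<otimes> b k \<in> VV' l})" ..
    obtain l U' where U': "l \<in> L" "openin X U'" "U' \<noteq> {}" "U' \<subseteq> ?U"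
        "U' \<subseteq> {x \<in> B. x \<otimes> b k \<in> VV' l}"
      using openin_subset_finite_UN_closedin[OF L(1) op ne sub
          closedin_X_translate_preimage[OF closedin_VV' b_closed]] .
    have "l \<noteq> k"
      using U' by blast
    then have "k - l \<noteq> 0" by simp
    from U'(2,3) this b_closed[of k] show False
    proof (rule no_open_overlap)
      fix x assume "x \<in> U'"
      then have *: "x \<otimes> b k \<in> VV' l"
        using U'(5) by blast
      show "x \<otimes> b k \<in> B" by (rule mem_VV'D[OF *])
      show "x \<otimes> b k \<otimes> (b k \<otimes> D (k - l)) \<in> B"
        using mem_VV'D(3)[OF *] by (simp only: b_diff)
    qed
  qed
  moreover have "?I \<subseteq> carrier G"
    using I B_subset by (auto simp: VV_def)
  ultimately have "?I \<subseteq> {x \<in> carrier G. x \<otimes> b k \<in> VV' k}"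
    by blast
  \<comment> \<open>The right-hand set is closed, so the inclusion passes from the interior to its
    closure.\<close>
  then have "VV' k \<subseteq> {x \<in> carrier G. x \<otimes> b k \<in> VV' k}"
    using closure_of_minimal[of ?I, OF _ closedin_translate_preimage[OF closedin_VV'[of k] b_closed[of k]]]
    unfolding VV'_def by (simp only:)
  with assms show ?thesis by blast
qed

text \<open>\<open>VV' k\<close> is closed and mapped into itself by the translation, so
  \<open>recurrent\<close> reverses the direction. The two arguments by backward steps below rest on
  this.\<close>

lemma VV'_translate_inv:
  assumes "x \<in> VV' k"
  shows "x \<otimes> inv (b k) \<in> VV' k"
  using recurrent[OF closedin_VV' b_closed VV'_translate assms] .

lemma VV'_coset_subset: "VV' k #> b k \<subseteq> VV' k"
  using VV'_translate by (auto simp: r_coset_def)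

text \<open>For x in the interior of \<open>VV k\<close>, x - b_k is again in \<open>B\<close>, and
  \<open>backward\<close> gives j in \<open>J\<close> with x - b_k - b_j in \<open>B\<close>. One j
  serves on a nonempty open set, which \<open>no_open_overlap\<close> forbids unless j = k.\<close>

lemma interior_VV_nonempty_imp_mem:
  assumes ne: "X interior_of VV k \<noteq> {}" and J: "finite J"
    and backward: "\<And>x. x \<in> B \<Longrightarrow> \<exists>j\<in>J. x \<otimes> inv (b j) \<in> B"
  shows "k \<in> J"
proof (rule ccontr)
  assume k: "k \<notin> J"
  let ?I = "X interior_of VV k"
  let ?C = "\<lambda>j. {x \<in> B. x \<otimes> (inv (b k) \<otimes> inv (b j)) \<in> B}"
  have inv_in: "x \<otimes> inv (b k) \<in> B" "x \<in> B" "x \<in> carrier G" if "x \<in> ?I" for x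
    using that interior_subset_VV'[of k] VV'_translate_inv[of x k] mem_VV'D[of _ k] by blast+
  have C: "closedin X (?C j)" for j
    by (intro closedin_X_translate_preimage closedin_B m_closed inv_closed b_closed)
  have "?I \<subseteq> (\<Union>j\<in>J. ?C j)"
  proof
    fix x assume x: "x \<in> ?I"
    obtain j where "j \<in> J" "x \<otimes> inv (b k) \<otimes> inv (b j) \<in> B"
      using backward[OF inv_in(1)[OF x]] by blast
    then show "x \<in> (\<Union>j\<in>J. ?C j)"
      using inv_in[OF x] by (auto simp: m_assoc b_closed D_closed y_closed)
  qed
  from openin_subset_finite_UN_closedin[OF J openin_interior_of ne this C]
  obtain j U' where U': "j \<in> J" "openin X U'" "U' \<noteq> {}" "U' \<subseteq> ?I" "U' \<subseteq> ?C j"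
    by this
  have "j - k \<noteq> 0"
    using k U'(1) by auto
  from U'(2,3) this inv_closed[OF b_closed[of k]] show False
  proof (rule no_open_overlap)
    fix x assume x: "x \<in> U'"
    show "x \<otimes> inv (b k) \<in> B"
      using x U'(4) inv_in by blast
    have "x \<otimes> (inv (b k) \<otimes> inv (b j)) \<in> B"
      using x U'(5) by blast
    then show "x \<otimes> inv (b k) \<otimes> (inv (b k) \<otimes> D (j - k)) \<in> B"
      unfolding inv_b_diff using inv_in(3)[of x] x U'(4)
      by (metis (no_types, lifting) b_closed inv_closed m_assoc subsetD)
  qed
qed

text \<open>A point of the overlap may also be moved back by b_j. So if x is in the interior of
  \<open>VV k\<close> and x - b_k in the overlap, then x, x - b_k and x - b_k - b_j all lie in
  \<open>B\<close>; a nonempty open set of such x contradicts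
  \<open>no_open_overlap\<close>.\<close>

lemma disjnt_interior_VV':
  assumes "j \<noteq> k"
  shows "disjnt (X interior_of VV' j) (X interior_of VV' k)"
proof (rule ccontr)
  let ?U = "X interior_of VV' j \<inter> X interior_of VV' k"
  assume "\<not> disjnt (X interior_of VV' j) (X interior_of VV' k)"
  then obtain u where u: "u \<in> ?U"
    by (auto simp: disjnt_def)
  have U: "?U \<subseteq> VV' j" "?U \<subseteq> VV' k"
    using interior_of_subset[of X] by blast+
  have "openin X ?U" by (simp add: openin_Int)
  then obtain Q where Q: "openin T Q" "?U = Q \<inter> B"
    by (auto simp: openin_subtopology)
  \<comment> \<open>The translate of \<open>?U\<close> by b_k need not be relatively open in
    \<open>B\<close>, but that of \<open>Q\<close> is open in the group. It meets \<open>?I\<close>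
    because u + b_k lies in \<open>VV' k\<close>, the closure of \<open>?I\<close>.\<close>
  let ?Q = "{x \<in> carrier G. x \<otimes> inv (b k) \<in> Q}"
  let ?I = "X interior_of VV k"
  have opQ: "openin T ?Q"
    by (rule openin_translate_preimage[OF Q(1) inv_closed[OF b_closed]])
  have uV: "u \<in> VV' k" "u \<in> Q"
    using u U Q(2) by blast+
  have ub: "u \<otimes> b k \<in> VV' k"
    by (rule VV'_translate[OF uV(1)])
  moreover have "u \<otimes> b k \<otimes> inv (b k) = u"
    using mem_VV'D(2)[OF uV(1)] b_closed by (metis inv_solve_right m_closed)
  ultimately have "u \<otimes> b k \<in> ?Q"
    using uV(2) mem_VV'D(2) by auto
  moreover have "\<forall>S. u \<otimes> b k \<in> S \<and> openin T S \<longrightarrow> (\<exists>x. x \<in> ?I \<and> x \<in> S)"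
    using ub by (simp add: VV'_def in_closure_of)
  ultimately have "\<exists>x. x \<in> ?I \<and> x \<in> ?Q"
    using opQ by (simp only:)
  then have ne: "?I \<inter> ?Q \<noteq> {}"
    by blast
  have "openin X (B \<inter> ?Q)"
    using opQ by (rule openin_subtopology_Int2)
  then have "openin X (?I \<inter> (B \<inter> ?Q))"
    by (rule openin_Int[OF openin_interior_of])
  moreover have "?I \<inter> ?Q = ?I \<inter> (B \<inter> ?Q)"
    using interior_of_subset[of X "VV k"] by (auto simp: VV_def)
  ultimately have op: "openin X (?I \<inter> ?Q)"
    by (simp only:)
  have inU: "x \<otimes> inv (b k) \<in> ?U" "x \<otimes> inv (b k) \<in> B" if "x \<in> ?I \<inter> ?Q" for x
  proof -
    show "x \<otimes> inv (b k) \<in> B"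
      using that interior_subset_VV'[of k] VV'_translate_inv[of x k] mem_VV'D(1)[of _ k] by blast
    with that show "x \<otimes> inv (b k) \<in> ?U"
      unfolding Q(2) by blast
  qed
  have "j - k \<noteq> 0"
    using assms by simp
  from op ne this inv_closed[OF b_closed[of k]] show False
  proof (rule no_open_overlap)
    fix x assume x: "x \<in> ?I \<inter> ?Q"
    show "x \<otimes> inv (b k) \<in> B" by (rule inU[OF x])
    show "x \<otimes> inv (b k) \<otimes> (inv (b k) \<otimes> D (j - k)) \<in> B"
      unfolding inv_b_diff using inU(1)[OF x] U(1) VV'_translate_inv mem_VV'D(1) by (meson subsetD)
  qed
qed

end

section \<open>The odometer as a topological group\<close>

locale period_structure =
  fixes p :: "nat \<Rightarrow> nat"
  assumes p_pos: "n \<ge> 1 \<Longrightarrow> p n > 0"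
    and p_dvd_Suc: "n \<ge> 1 \<Longrightarrow> p n dvd p (Suc n)"
begin

abbreviation "G \<equiv> odometer p"
abbreviation "T \<equiv> odometer_top p"

lemma p_dvd: "1 \<le> i \<Longrightarrow> i \<le> n \<Longrightarrow> p i dvd p n"
  by (rule nat_induct_at_least[of i n "\<lambda>n. p i dvd p n"]) (auto intro: dvd_trans[OF _ p_dvd_Suc])

lemma carrier_odometer:
  "carrier G = {g \<in> extensional {1..}. (\<forall>n\<ge>1. 0 \<le> g n \<and> g n < int (p n)) \<and>
     (\<forall>n\<ge>1. g (Suc n) mod int (p n) = g n)}"
  using p_pos by (auto simp: odometer_def carrier_integer_mod_group PiE_iff)

lemma mult_odometer: "g \<otimes>\<^bsub>G\<^esub> h = (\<lambda>n\<in>{1..}. (g n + h n) mod int (p n))"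
  by (simp add: odometer_def)

lemma one_odometer: "\<one>\<^bsub>G\<^esub> = (\<lambda>n\<in>{1..}. 0)"
  by (simp add: odometer_def product_group_def)

lemma mod_mod_p: "n \<ge> 1 \<Longrightarrow> (a mod int (p (Suc n))) mod int (p n) = a mod int (p n)"
  using p_dvd_Suc by (simp add: mod_mod_cancel)

text \<open>Coherence may be checked before reduction, as reducing modulo \<open>p (Suc n)\<close>
  does not change residues modulo \<open>p n\<close>.\<close>

lemma mem_carrier_odometerI:
  assumes "\<And>n. n \<ge> 1 \<Longrightarrow> a (Suc n) mod int (p n) = a n mod int (p n)"
  shows "(\<lambda>n\<in>{1..}. a n mod int (p n)) \<in> carrier G"
  using assms p_pos by (auto simp: carrier_odometer mod_mod_p)

text \<open>Iterated coherence: a coordinate determines all earlier ones, so cylinders are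
  nested.\<close>

lemma odometer_cong:
  assumes "g \<in> carrier G" "1 \<le> i" "i \<le> n"
  shows "g n mod int (p i) = g i"
  using assms(3)
proof (induction n rule: dec_induct)
  case base
  then show ?case using assms(1,2) by (simp add: carrier_odometer)
next
  case (step n)
  have "g (Suc n) mod int (p i) = (g (Suc n) mod int (p n)) mod int (p i)"
    using p_dvd[OF assms(2) step.hyps(1)] by (simp add: mod_mod_cancel)
  then show ?case
    using step assms by (simp add: carrier_odometer)
qed

lemma comm_group_odometer: "comm_group G"
proof (rule comm_groupI)
  fix g h k assume g: "g \<in> carrier G" and h: "h \<in> carrier G"
  show "g \<otimes>\<^bsub>G\<^esub> h \<in> carrier G"
    unfolding mult_odometer
  proof (rule mem_carrier_odometerI)
    fix n :: nat assume "n \<ge> 1"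
    then have "g (Suc n) mod int (p n) = g n" "h (Suc n) mod int (p n) = h n"
      using g h by (auto simp: carrier_odometer)
    then show "(g (Suc n) + h (Suc n)) mod int (p n) = (g n + h n) mod int (p n)"
      by (metis mod_add_eq)
  qed
  show "g \<otimes>\<^bsub>G\<^esub> h = h \<otimes>\<^bsub>G\<^esub> g"
    by (simp add: mult_odometer add.commute)
  show "\<one>\<^bsub>G\<^esub> \<otimes>\<^bsub>G\<^esub> g = g"
    using g by (auto simp: mult_odometer one_odometer carrier_odometer extensional_def fun_eq_iff)
  show "g \<otimes>\<^bsub>G\<^esub> h \<otimes>\<^bsub>G\<^esub> k = g \<otimes>\<^bsub>G\<^esub> (h \<otimes>\<^bsub>G\<^esub> k)"
    by (auto simp: mult_odometer fun_eq_iff mod_simps add.assoc)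
  show "\<exists>h\<in>carrier G. h \<otimes>\<^bsub>G\<^esub> g = \<one>\<^bsub>G\<^esub>"
  proof
    show "(\<lambda>n\<in>{1..}. (- g n) mod int (p n)) \<in> carrier G"
    proof (rule mem_carrier_odometerI)
      fix n :: nat assume "n \<ge> 1"
      then have "g (Suc n) mod int (p n) = g n"
        using g by (auto simp: carrier_odometer)
      then show "- g (Suc n) mod int (p n) = - g n mod int (p n)"
        by (metis mod_minus_eq)
    qed
    show "(\<lambda>n\<in>{1..}. (- g n) mod int (p n)) \<otimes>\<^bsub>G\<^esub> g = \<one>\<^bsub>G\<^esub>"
      by (auto simp: mult_odometer one_odometer fun_eq_iff mod_simps)
  qed
next
  show "\<one>\<^bsub>G\<^esub> \<in> carrier G"
    using p_pos by (auto simp: one_odometer carrier_odometer)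
qed

sublocale G: comm_group G
  by (rule comm_group_odometer)

section \<open>The integers inside the odometer\<close>

lemma Delta_closed [simp]: "\<Delta> p k \<in> carrier G"
  unfolding \<Delta>_def by (rule mem_carrier_odometerI) simp

lemma Delta_add: "\<Delta> p (j + k) = \<Delta> p j \<otimes>\<^bsub>G\<^esub> \<Delta> p k"
  by (auto simp: \<Delta>_def mult_odometer fun_eq_iff mod_simps)

lemma Delta_0: "\<Delta> p 0 = \<one>\<^bsub>G\<^esub>"
  by (auto simp: \<Delta>_def one_odometer fun_eq_iff)

lemma Delta_minus: "\<Delta> p (- k) = inv\<^bsub>G\<^esub> \<Delta> p k"
  by (rule G.inv_equality[symmetric]) (simp_all flip: Delta_add Delta_0)

lemma Delta_diff: "\<Delta> p (j - k) = \<Delta> p j \<otimes>\<^bsub>G\<^esub> inv\<^bsub>G\<^esub> \<Delta> p k"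
  using Delta_add[of j "- k"] by (simp add: Delta_minus)

text \<open>Two-sided induction, the downward step by cancelling \<Delta>(1). It serves for the
  images of shift orbits under \<open>\<pi>\<close> and under
  \<open>\<pi> \<circ> F\<close>.\<close>

lemma orbit_Delta:
  fixes f :: "int \<Rightarrow> nat \<Rightarrow> int"
  assumes "\<And>s. f s \<in> carrier G" "\<And>s. f (s + 1) = f s \<otimes>\<^bsub>G\<^esub> \<Delta> p 1"
  shows "f s = f 0 \<otimes>\<^bsub>G\<^esub> \<Delta> p s"
proof (induction s rule: int_induct[of _ 0])
  case base
  show ?case using assms(1) by (simp add: Delta_0)
next
  case (step1 i)
  then show ?case using assms by (simp add: Delta_add G.m_assoc)
next
  case (step2 i)
  have "f (i - 1) \<otimes>\<^bsub>G\<^esub> \<Delta> p 1 = f 0 \<otimes>\<^bsub>G\<^esub> \<Delta> p (i - 1) \<otimes>\<^bsub>G\<^esub> \<Delta> p 1"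
    using step2 assms(2)[of "i - 1"] Delta_add[of "i - 1" 1] assms(1) by (simp add: G.m_assoc)
  then show ?case
    using assms(1) by (simp add: G.right_cancel)
qed

section \<open>Topology of the odometer: cylinders, density of the integers, recurrence\<close>

lemma topspace_odometer_top: "topspace T = carrier G"
  by (auto simp: odometer_top_def odometer_def)

lemma continuous_map_coordinate:
  "n \<ge> 1 \<Longrightarrow> continuous_map T (discrete_topology (carrier (integer_mod_group (p n)))) (\<lambda>g. g n)"
  unfolding odometer_top_def
  by (rule continuous_map_from_subtopology, rule continuous_map_product_projection) simp

lemma continuous_map_into_odometer:
  assumes "\<And>x. x \<in> topspace Y \<Longrightarrow> f x \<in> carrier G"
    and "\<And>n. n \<ge> 1 \<Longrightarrow> continuous_map Y (discrete_topology (carrier (integer_mod_group (p n)))) (\<lambda>x. f x n)"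
  shows "continuous_map Y T f"
  using assms unfolding odometer_top_def
  by (auto simp: continuous_map_in_subtopology continuous_map_componentwise carrier_odometer Pi_iff)

lemma continuous_map_translation:
  assumes "a \<in> carrier G"
  shows "continuous_map T T (\<lambda>g. g \<otimes>\<^bsub>G\<^esub> a)"
proof (rule continuous_map_into_odometer)
  fix n :: nat assume n: "n \<ge> 1"
  have "continuous_map (discrete_topology (carrier (integer_mod_group (p n))))
      (discrete_topology (carrier (integer_mod_group (p n)))) (\<lambda>c. (c + a n) mod int (p n))"
    using p_pos[OF n] by (auto simp: carrier_integer_mod_group)
  from continuous_map_compose[OF continuous_map_coordinate[OF n] this]
  show "continuous_map T (discrete_topology (carrier (integer_mod_group (p n)))) (\<lambda>g. (g \<otimes>\<^bsub>G\<^esub> a) n)"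
    using n by (simp add: mult_odometer o_def)
qed (use assms in \<open>simp add: topspace_odometer_top\<close>)

lemma openin_cylinder: "n \<ge> 1 \<Longrightarrow> openin T (cylinder p n h)"
proof -
  assume n: "n \<ge> 1"
  \<comment> \<open>\<open>h\<close> is arbitrary, so \<open>h n\<close> may fail to be a residue;
    the intersection keeps the set inside the discrete space.\<close>
  have "openin T {g \<in> topspace T. g n \<in> {h n} \<inter> carrier (integer_mod_group (p n))}"
    by (rule openin_continuous_map_preimage[OF continuous_map_coordinate[OF n]]) simp
  moreover have "{g \<in> topspace T. g n \<in> {h n} \<inter> carrier (integer_mod_group (p n))} = cylinder p n h"
    using n p_pos[OF n]
    by (auto simp: cylinder_def topspace_odometer_top carrier_integer_mod_group carrier_odometer)
  ultimately show ?thesis by simp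
qed

lemma Hausdorff_odometer: "Hausdorff_space T"
  unfolding odometer_top_def
  by (rule Hausdorff_space_subtopology) (simp add: Hausdorff_space_product_topology)

lemma cylinder_mono:
  assumes "1 \<le> i" "i \<le> n" "g \<in> carrier G"
  shows "cylinder p n g \<subseteq> cylinder p i g"
proof
  fix h assume "h \<in> cylinder p n g"
  then have "h \<in> carrier G" "h n = g n"
    by (simp_all add: cylinder_def)
  then show "h \<in> cylinder p i g"
    using odometer_cong[of h i n] odometer_cong[OF assms(3,1,2)] assms(1,2) by (simp add: cylinder_def)
qed

text \<open>A basic open set of the product restricts finitely many coordinates, and by coherence
  agreement at one high level settles them all.\<close>

lemma openin_cylinder_basis:
  assumes "openin T S" "g \<in> S"
  shows "\<exists>n\<ge>N. n \<ge> 1 \<and> cylinder p n g \<subseteq> S"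
proof -
  let ?Y = "\<lambda>n. discrete_topology (carrier (integer_mod_group (p n)))"
  obtain R where R: "openin (product_topology ?Y {1..}) R" "S = R \<inter> carrier G"
    using assms(1) by (auto simp: odometer_top_def openin_subtopology)
  then obtain U where U: "finite {i \<in> {1..}. U i \<noteq> topspace (?Y i)}"
      "g \<in> Pi\<^sub>E {1..} U" "Pi\<^sub>E {1..} U \<subseteq> R"
    using R(1)[unfolded openin_product_topology_alt] assms(2) by blast
  define J where "J = {i \<in> {1..}. U i \<noteq> topspace (?Y i)}"
  \<comment> \<open>A level above all restricted coordinates; 1 and \<open>N\<close> are inserted to
    meet the two lower bounds.\<close>
  define n where "n = Max (insert 1 (insert N J))"
  have n: "n \<ge> 1" "n \<ge> N" "\<And>i. i \<ge> 1 \<Longrightarrow> U i \<noteq> topspace (?Y i) \<Longrightarrow> i \<le> n"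
  proof -
    have fin: "finite (insert 1 (insert N J))"
      using U(1) by (simp add: J_def)
    show "n \<ge> 1" "n \<ge> N"
      unfolding n_def using fin by (blast intro: Max_ge)+
    show "i \<le> n" if "i \<ge> 1" "U i \<noteq> topspace (?Y i)" for i
    proof -
      have "i \<in> J" unfolding J_def using that by simp
      then show ?thesis unfolding n_def using fin by (blast intro: Max_ge)
    qed
  qed
  have g: "g \<in> carrier G"
    using assms(2) R(2) by blast
  have "cylinder p n g \<subseteq> R"
  proof
    fix h assume h: "h \<in> cylinder p n g"
    have "h \<in> Pi\<^sub>E {1..} U"
    proof (rule PiE_I)
      fix i :: nat assume "i \<in> {1..}"
      then have i: "i \<ge> 1" by simp
      show "h i \<in> U i"
      proof (cases "U i = topspace (?Y i)")
        case True
        then show ?thesis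
          using h i p_pos[OF i] by (auto simp: cylinder_def carrier_odometer carrier_integer_mod_group)
      next
        case False
        then have "h i = g i"
          using h cylinder_mono[OF i n(3)[OF i False] g] by (auto simp: cylinder_def)
        then show ?thesis
          using U(2) i by auto
      qed
    next
      fix i :: nat assume "i \<notin> {1..}"
      then show "h i = undefined"
        using h by (auto simp: cylinder_def carrier_odometer extensional_def)
    qed
    then show "h \<in> R" using U(3) by blast
  qed
  then have "cylinder p n g \<subseteq> S"
    using R(2) by (auto simp: cylinder_def)
  with n(1,2) show ?thesis by blast
qed

lemma Delta_in_cylinder: "g \<in> carrier G \<Longrightarrow> n \<ge> 1 \<Longrightarrow> \<Delta> p (g n) \<in> cylinder p n g"
  using Delta_closed[of "g n"] by (simp add: cylinder_def \<Delta>_def carrier_odometer)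

text \<open>Density of the integers: the integer \<open>g M\<close> approximates \<open>g\<close> up
  to level \<open>M\<close>.\<close>

lemma openin_contains_Delta:
  assumes "openin T S" "g \<in> S" "n \<ge> 1"
  obtains j where "\<Delta> p j \<in> S" "j mod int (p n) = g n"
proof -
  obtain M where M: "M \<ge> n" "cylinder p M g \<subseteq> S"
    using openin_cylinder_basis[OF assms(1,2), of n] by auto
  have g: "g \<in> carrier G"
    using assms(1,2) openin_subset topspace_odometer_top by blast
  show ?thesis
    using that[of "g M"] Delta_in_cylinder[OF g] odometer_cong[OF g assms(3) M(1)] M assms(3)
    by (meson le_trans subsetD)
qed

lemma pow_odometer:
  "n \<ge> 1 \<Longrightarrow> a \<in> carrier G \<Longrightarrow> (a [^]\<^bsub>G\<^esub> (k::nat)) n = (int k * a n) mod int (p n)"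
  by (induction k) (auto simp: one_odometer mult_odometer mod_simps algebra_simps)

text \<open>Adding \<open>a\<close> exactly \<open>p n\<close> times does not change coordinate
  \<open>n\<close>. Hence \<open>p n - 1\<close> steps from \<open>x\<close> lead into the
  level-\<open>n\<close> cylinder about x - a while staying in \<open>S\<close>, and
  \<open>S\<close> is closed.\<close>

lemma closed_translation_invariant_inv:
  assumes "closedin T S" "a \<in> carrier G" "\<And>x. x \<in> S \<Longrightarrow> x \<otimes>\<^bsub>G\<^esub> a \<in> S" "x \<in> S"
  shows "x \<otimes>\<^bsub>G\<^esub> inv\<^bsub>G\<^esub> a \<in> S"
proof (rule ccontr)
  let ?z = "x \<otimes>\<^bsub>G\<^esub> inv\<^bsub>G\<^esub> a"
  assume nin: "?z \<notin> S"
  have x: "x \<in> carrier G"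
    using assms closedin_subset topspace_odometer_top by blast
  then have "?z \<in> topspace T - S"
    using nin assms(2) by (simp add: topspace_odometer_top)
  moreover have "openin T (topspace T - S)"
    using assms(1) by blast
  ultimately obtain n where n: "n \<ge> 1" "cylinder p n ?z \<subseteq> topspace T - S"
    using openin_cylinder_basis by blast
  have pow: "x \<otimes>\<^bsub>G\<^esub> a [^]\<^bsub>G\<^esub> k \<in> S" for k :: nat
  proof (induction k)
    case (Suc k)
    then show ?case
      using assms(3)[OF Suc] x assms(2) by (simp add: G.m_assoc)
  qed (use x assms(4) in simp)
  define k where "k = p n - 1"
  have kn: "int k + 1 = int (p n)"
    using p_pos[OF n(1)] by (simp add: k_def)
  let ?w = "x \<otimes>\<^bsub>G\<^esub> a [^]\<^bsub>G\<^esub> k"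
  have w: "?w \<in> carrier G"
    using x assms(2) by simp
  have "?w \<otimes>\<^bsub>G\<^esub> a = x \<otimes>\<^bsub>G\<^esub> a [^]\<^bsub>G\<^esub> (Suc k)"
    using x assms(2) by (simp add: G.m_assoc)
  moreover have "(x \<otimes>\<^bsub>G\<^esub> a [^]\<^bsub>G\<^esub> (Suc k)) n = x n"
    using n(1) pow_odometer[OF n(1) assms(2), of "Suc k"] kn x
    by (simp add: mult_odometer carrier_odometer add.commute del: G.nat_pow_Suc)
  ultimately have "(?w \<otimes>\<^bsub>G\<^esub> a \<otimes>\<^bsub>G\<^esub> inv\<^bsub>G\<^esub> a) n = ?z n"
    using n(1) by (simp add: mult_odometer)
  then have "?w n = ?z n"
    using w assms(2) by (simp add: G.m_assoc)
  then have "?w \<in> cylinder p n ?z"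
    using w by (simp add: cylinder_def)
  then show False
    using pow n(2) by blast
qed

end

section \<open>Toeplitz subshifts over the odometer\<close>

definition translate :: "int \<Rightarrow> (int \<Rightarrow> bool) \<Rightarrow> (int \<Rightarrow> bool)" where
  "translate k x = (\<lambda>s. x (s + k))"

lemma translate_0 [simp]: "translate 0 x = x"
  by (simp add: translate_def)

lemma translate_add_one: "translate (k + 1) x = shift (translate k x)"
  by (simp add: translate_def shift_def add_ac)

lemma continuous_on_translate: "continuous_on S (translate k)"
  unfolding translate_def
  by (intro continuous_on_coordinatewise_then_product)
    (rule continuous_on_subset[OF continuous_on_product_coordinates subset_UNIV])

lemma orbit_closure_eq: "orbit_closure \<eta> = closure (range (\<lambda>k. translate k \<eta>))"
  by (simp add: orbit_closure_def translate_def)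

lemma translate_in_orbit_closure: "translate k \<eta> \<in> orbit_closure \<eta>"
  unfolding orbit_closure_eq by (rule subsetD[OF closure_subset]) simp

lemma translate_orbit_closure:
  assumes "x \<in> orbit_closure \<eta>"
  shows "translate k x \<in> orbit_closure \<eta>"
proof -
  have "translate k (translate j \<eta>) = translate (k + j) \<eta>" for j
    by (simp add: translate_def add_ac)
  then have "translate k ` range (\<lambda>k. translate k \<eta>) \<subseteq> orbit_closure \<eta>"
    using translate_in_orbit_closure by auto
  then have "translate k ` closure (range (\<lambda>k. translate k \<eta>)) \<subseteq> orbit_closure \<eta>"
    by (intro image_closure_subset continuous_on_translate) (simp_all add: orbit_closure_eq)
  with assms show ?thesis
    unfolding orbit_closure_eq by blast
qed

lemma open_coordinate: "open {x :: int \<Rightarrow> bool. x s = i}"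
proof -
  have "open ((\<lambda>x :: int \<Rightarrow> bool. x s) -` {i})"
    by (intro open_vimage continuous_on_product_coordinates open_discrete)
  then show ?thesis by (simp add: vimage_def)
qed

lemma closed_coordinate: "closed {x :: int \<Rightarrow> bool. x s = i}"
proof -
  have "- {x :: int \<Rightarrow> bool. x s = i} = {x. x s = (\<not> i)}"
    by auto
  then show ?thesis
    using open_coordinate unfolding closed_def by metis
qed

text \<open>Tychonoff's theorem, carried over to the type class topology on functions.\<close>

lemma compact_UNIV_int_bool: "compact (UNIV :: (int \<Rightarrow> bool) set)"
proof -
  have "compact (UNIV :: bool set)"
    by (rule finite_imp_compact) simp
  then have "compact_space (euclidean :: bool topology)"
    by (simp add: compact_space_def)
  then have "compact_space (product_topology (\<lambda>i :: int. euclidean :: bool topology) UNIV)"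
    by (simp add: compact_space_product_topology)
  then show ?thesis
    by (simp add: euclidean_product_topology compact_space_def)
qed

lemma compact_orbit_closure_coordinate: "compact {x \<in> orbit_closure \<eta>. x s = i}"
proof -
  have "closed (orbit_closure \<eta> \<inter> {x. x s = i})"
    unfolding orbit_closure_eq by (intro closed_Int closed_coordinate closed_closure)
  from compact_Int_closed[OF compact_UNIV_int_bool this] show ?thesis
    by (simp add: Int_def)
qed

locale toeplitz_factor = period_structure +
  fixes \<eta> :: "int \<Rightarrow> bool" and \<pi> :: "(int \<Rightarrow> bool) \<Rightarrow> (nat \<Rightarrow> int)"
  assumes toeplitz: "\<exists>n\<ge>1. \<forall>j. \<eta> (k + int (p n) * j) = \<eta> k"
    and continuous_factor: "continuous_map (top_of_set (orbit_closure \<eta>)) T \<pi>"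
    and factor_shift: "x \<in> orbit_closure \<eta> \<Longrightarrow> \<pi> (shift x) = \<pi> x \<otimes>\<^bsub>G\<^esub> \<Delta> p 1"
    and factor_base: "\<pi> \<eta> = \<Delta> p 0"
begin

lemma factor_closed: "x \<in> orbit_closure \<eta> \<Longrightarrow> \<pi> x \<in> carrier G"
  using continuous_factor by (auto simp: continuous_map_def topspace_odometer_top)

lemma factor_translate:
  assumes "x \<in> orbit_closure \<eta>"
  shows "\<pi> (translate k x) = \<pi> x \<otimes>\<^bsub>G\<^esub> \<Delta> p k"
  using orbit_Delta[of "\<lambda>k. \<pi> (translate k x)" k] assms
  by (simp add: factor_closed translate_orbit_closure translate_add_one factor_shift)

lemma base_in_orbit_closure: "\<eta> \<in> orbit_closure \<eta>"
  using translate_in_orbit_closure[of 0 \<eta>] by simp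

lemma factor_translate_base: "\<pi> (translate k \<eta>) = \<Delta> p k"
  by (simp add: factor_translate base_in_orbit_closure factor_base flip: Delta_add)

text \<open>By \<open>factor_translate_base\<close>, this is the image under \<open>\<pi>\<close> of
  the orbit points of \<eta> with symbol \<open>i\<close> at 0.\<close>

definition E :: "bool \<Rightarrow> (nat \<Rightarrow> int) set" where
  "E i = {\<Delta> p k |k. \<eta> k = i}"

text \<open>The image is compact, hence closed, and contains \<open>E i\<close>. Conversely, fixing
  the symbol at 0 is an open condition, so each such point is a limit of orbit points with that
  symbol, and \<open>\<pi>\<close> is continuous.\<close>

lemma factor_image_coordinate: "\<pi> ` {x \<in> orbit_closure \<eta>. x 0 = i} = T closure_of E i"
proof
  let ?X = "orbit_closure \<eta>"
  have "compactin (top_of_set ?X) {x \<in> ?X. x 0 = i}"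
    using compact_orbit_closure_coordinate by (simp add: compactin_subtopology)
  from image_compactin[OF this continuous_factor]
  have "closedin T (\<pi> ` {x \<in> ?X. x 0 = i})"
    by (rule compactin_imp_closedin[OF Hausdorff_odometer])
  moreover have "E i \<subseteq> \<pi> ` {x \<in> ?X. x 0 = i}"
  proof
    fix g assume "g \<in> E i"
    then obtain k where k: "g = \<Delta> p k" "\<eta> k = i"
      by (auto simp: E_def)
    then have "translate k \<eta> \<in> {x \<in> ?X. x 0 = i}"
      using translate_in_orbit_closure by (simp add: translate_def)
    then show "g \<in> \<pi> ` {x \<in> ?X. x 0 = i}"
      unfolding k(1) factor_translate_base[of k, symmetric] by (rule imageI)
  qed
  ultimately show "T closure_of E i \<subseteq> \<pi> ` {x \<in> ?X. x 0 = i}"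
    by (intro closure_of_minimal)
  show "\<pi> ` {x \<in> ?X. x 0 = i} \<subseteq> T closure_of E i"
  proof clarify
    fix x assume x: "x \<in> ?X" and i: "i = x 0"
    show "\<pi> x \<in> T closure_of E (x 0)"
      unfolding in_closure_of
    proof (intro conjI allI impI)
      show "\<pi> x \<in> topspace T"
        using x by (simp add: factor_closed topspace_odometer_top)
      fix S assume S: "\<pi> x \<in> S \<and> openin T S"
      then have "openin (top_of_set ?X) {z \<in> ?X. \<pi> z \<in> S}"
        using openin_continuous_map_preimage[OF continuous_factor] by simp
      then obtain R where R: "open R" "{z \<in> ?X. \<pi> z \<in> S} = ?X \<inter> R"
        by (auto simp: openin_open)
      have "open (R \<inter> {z. z 0 = x 0})"
        using R(1) open_coordinate by (rule open_Int)
      moreover have "x \<in> R \<inter> {z. z 0 = x 0}"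
        using x S R(2) by blast
      ultimately have "R \<inter> {z. z 0 = x 0} \<inter> range (\<lambda>k. translate k \<eta>) \<noteq> {}"
        using x open_Int_closure_eq_empty unfolding orbit_closure_eq by blast
      then obtain k where k: "translate k \<eta> \<in> R \<inter> {z. z 0 = x 0}"
        by blast
      then have "\<pi> (translate k \<eta>) \<in> S"
        using R(2) translate_in_orbit_closure by blast
      then have "\<Delta> p k \<in> S"
        by (simp add: factor_translate_base)
      moreover have "\<Delta> p k \<in> E (x 0)"
        using k by (auto simp: E_def translate_def)
      ultimately show "\<exists>g. g \<in> E (x 0) \<and> g \<in> S" by blast
    qed
  qed
qed

section \<open>The window \<open>W\<close> and its boundary\<close>

lemma openin_V: "openin T (V p \<eta> i)"
  unfolding V_def by (auto intro!: openin_Union openin_cylinder)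

lemma Delta_in_V: "\<Delta> p k \<in> V p \<eta> (\<eta> k)"
proof -
  obtain n where n: "n \<ge> 1" "\<And>j. \<eta> (k + int (p n) * j) = \<eta> k"
    using toeplitz by blast
  let ?k = "k mod int (p n)"
  have "?k + int (p n) * j = k + int (p n) * (j - k div int (p n))" for j
    unfolding minus_mult_div_eq_mod[symmetric] by (simp add: algebra_simps)
  then have "?k \<in> Per p \<eta> (\<eta> k) n \<inter> {0..<int (p n)}"
    using n p_pos[OF n(1)] by (simp add: Per_def)
  moreover have "\<Delta> p k \<in> cylinder p n (\<Delta> p ?k)"
    using Delta_closed[of k] n(1) by (simp add: cylinder_def \<Delta>_def)
  ultimately show ?thesis
    unfolding V_def using n(1) by blast
qed

lemma Delta_in_V_iff: "\<Delta> p k \<in> V p \<eta> i \<longleftrightarrow> \<eta> k = i"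
proof
  assume "\<Delta> p k \<in> V p \<eta> i"
  then obtain n l where n: "n \<ge> 1" "l \<in> Per p \<eta> i n" "\<Delta> p k \<in> cylinder p n (\<Delta> p l)"
    by (auto simp: V_def)
  then have "k mod int (p n) = l mod int (p n)"
    by (simp add: cylinder_def \<Delta>_def)
  then obtain j where "k = l + int (p n) * j"
    by (metis mod_eqE)
  then show "\<eta> k = i"
    using n(2) by (simp add: Per_def)
qed (use Delta_in_V in blast)

text \<open>The intersection is open, so if nonempty it would contain some \<Delta>(j), with
  \<eta>(j) both 1 and 0.\<close>

lemma V_disjoint: "V p \<eta> True \<inter> V p \<eta> False = {}"
proof (rule ccontr)
  assume "V p \<eta> True \<inter> V p \<eta> False \<noteq> {}"
  then obtain g where g: "g \<in> V p \<eta> True \<inter> V p \<eta> False" by blast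
  obtain j where "\<Delta> p j \<in> V p \<eta> True \<inter> V p \<eta> False"
    using openin_contains_Delta[OF openin_Int[OF openin_V openin_V] g, of 1] by auto
  then show False by (simp add: Delta_in_V_iff)
qed

lemma closure_of_open_eq:
  assumes "openin T S"
  shows "T closure_of S = T closure_of {\<Delta> p k |k. \<Delta> p k \<in> S}"
proof
  have "S \<subseteq> T closure_of {\<Delta> p k |k. \<Delta> p k \<in> S}"
  proof
    fix g assume g: "g \<in> S"
    show "g \<in> T closure_of {\<Delta> p k |k. \<Delta> p k \<in> S}"
      unfolding in_closure_of
    proof (intro conjI allI impI)
      show "g \<in> topspace T"
        using g assms openin_subset by blast
      fix R assume "g \<in> R \<and> openin T R"
      then obtain j where "\<Delta> p j \<in> S \<inter> R"
        using openin_contains_Delta[OF openin_Int[OF assms, of R], of g 1] g by auto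
      then show "\<exists>h. h \<in> {\<Delta> p k |k. \<Delta> p k \<in> S} \<and> h \<in> R" by blast
    qed
  qed
  then show "T closure_of S \<subseteq> T closure_of {\<Delta> p k |k. \<Delta> p k \<in> S}"
    by (intro closure_of_minimal) simp_all
qed (rule closure_of_mono, blast)

lemma W_eq: "W p \<eta> = T closure_of E True"
  unfolding W_def closure_of_open_eq[OF openin_V] by (simp add: Delta_in_V_iff E_def)

lemma Delta_in_W_iff: "\<Delta> p k \<in> W p \<eta> \<longleftrightarrow> \<eta> k"
proof
  assume "\<Delta> p k \<in> W p \<eta>"
  then have "\<Delta> p k \<notin> V p \<eta> False"
    using V_disjoint openin_V[of False] unfolding W_def in_closure_of by blast
  then show "\<eta> k" by (simp add: Delta_in_V_iff)
next
  assume "\<eta> k"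
  then have "\<Delta> p k \<in> E True"
    by (auto simp: E_def)
  moreover have "E True \<subseteq> topspace T"
    by (auto simp: E_def topspace_odometer_top)
  ultimately show "\<Delta> p k \<in> W p \<eta>"
    unfolding W_eq using closure_of_subset by blast
qed

text \<open>The complement of \<open>W\<close> is open, so its closure is that of the integers in
  it, and these are the zeros of \<eta>.\<close>

lemma bdW_eq: "bdW p \<eta> = T closure_of E True \<inter> T closure_of E False"
proof -
  have "openin T (topspace T - W p \<eta>)"
    unfolding W_eq by (intro openin_diff openin_topspace closedin_closure_of)
  from closure_of_open_eq[OF this]
  have "T closure_of (topspace T - W p \<eta>) = T closure_of E False"
    by (simp add: topspace_odometer_top Delta_in_W_iff E_def)
  moreover have "T closure_of W p \<eta> = T closure_of E True"
    by (simp add: W_eq)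
  ultimately show ?thesis
    by (simp add: bdW_def frontier_of_closures)
qed

lemma mem_bdW_iff:
  "g \<in> bdW p \<eta> \<longleftrightarrow> (\<exists>x\<in>orbit_closure \<eta>. \<exists>z\<in>orbit_closure \<eta>. \<pi> x = g \<and> \<pi> z = g \<and> x 0 \<and> \<not> z 0)"
  (is "_ \<longleftrightarrow> ?R")
proof
  assume "g \<in> bdW p \<eta>"
  then have "g \<in> \<pi> ` {x \<in> orbit_closure \<eta>. x 0 = True}" "g \<in> \<pi> ` {x \<in> orbit_closure \<eta>. x 0 = False}"
    unfolding bdW_eq factor_image_coordinate by blast+
  then show ?R
    by (elim imageE CollectE conjE) auto
next
  assume ?R
  then obtain x z where "x \<in> orbit_closure \<eta>" "z \<in> orbit_closure \<eta>" "g = \<pi> x" "g = \<pi> z" "x 0" "\<not> z 0"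
    by auto
  then have "g \<in> \<pi> ` {x \<in> orbit_closure \<eta>. x 0 = True}" "g \<in> \<pi> ` {x \<in> orbit_closure \<eta>. x 0 = False}"
    by (auto intro: image_eqI[of _ _ x] image_eqI[of _ _ z])
  then show "g \<in> bdW p \<eta>"
    unfolding bdW_eq factor_image_coordinate by (rule IntI)
qed

text \<open>Shifting by \<open>s\<close> moves the difference to position 0; the cases only decide
  which point carries the 1.\<close>

lemma differing_fibre_imp_bdW:
  assumes "x \<in> orbit_closure \<eta>" "z \<in> orbit_closure \<eta>" "\<pi> x = \<pi> z" "x s \<noteq> z s"
  shows "\<pi> x \<otimes>\<^bsub>G\<^esub> \<Delta> p s \<in> bdW p \<eta>"
proof -
  have val: "translate s x 0 = x s" "translate s z 0 = z s"
    by (simp_all add: translate_def)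
  have fac: "\<pi> (translate s x) = \<pi> x \<otimes>\<^bsub>G\<^esub> \<Delta> p s" "\<pi> (translate s z) = \<pi> x \<otimes>\<^bsub>G\<^esub> \<Delta> p s"
    using assms(1-3) by (simp_all add: factor_translate)
  have orb: "translate s x \<in> orbit_closure \<eta>" "translate s z \<in> orbit_closure \<eta>"
    using assms(1,2) by (simp_all add: translate_orbit_closure)
  show ?thesis
  proof (cases "x s")
    case True
    then show ?thesis
      unfolding mem_bdW_iff
      by (intro bexI[OF _ orb(1)] bexI[OF _ orb(2)]) (use assms(4) in \<open>simp add: val fac\<close>)
  next
    case False
    then show ?thesis
      unfolding mem_bdW_iff
      by (intro bexI[OF _ orb(2)] bexI[OF _ orb(1)]) (use assms(4) in \<open>simp add: val fac\<close>)
  qed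
qed

lemma bdW_subset: "bdW p \<eta> \<subseteq> carrier G"
  using factor_closed by (auto simp: mem_bdW_iff)

end

section \<open>Automorphisms and the rotations they induce\<close>

locale toeplitz_automorphism = toeplitz_factor +
  fixes F :: "(int \<Rightarrow> bool) \<Rightarrow> (int \<Rightarrow> bool)"
  assumes aut: "automorphism (orbit_closure \<eta>) F"
begin

abbreviation "y \<equiv> y_of p \<eta> \<pi> F"

lemma continuous_on_F: "continuous_on (orbit_closure \<eta>) F"
  and F_closed: "x \<in> orbit_closure \<eta> \<Longrightarrow> F x \<in> orbit_closure \<eta>"
  and inj_on_F: "inj_on F (orbit_closure \<eta>)"
  and F_surj: "F ` orbit_closure \<eta> = orbit_closure \<eta>"
  and F_shift: "x \<in> orbit_closure \<eta> \<Longrightarrow> F (shift x) = shift (F x)"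
proof -
  have h: "homeomorphic_map (top_of_set (orbit_closure \<eta>)) (top_of_set (orbit_closure \<eta>)) F"
    using aut by (simp add: automorphism_def)
  from homeomorphic_imp_continuous_map[OF h]
  show "continuous_on (orbit_closure \<eta>) F" by simp
  from homeomorphic_imp_injective_map[OF h] show "inj_on F (orbit_closure \<eta>)" by simp
  from homeomorphic_imp_surjective_map[OF h] show "F ` orbit_closure \<eta> = orbit_closure \<eta>" by simp
  then show "x \<in> orbit_closure \<eta> \<Longrightarrow> F x \<in> orbit_closure \<eta>" by blast
  show "x \<in> orbit_closure \<eta> \<Longrightarrow> F (shift x) = shift (F x)"
    using aut by (simp add: automorphism_def)
qed

text \<open>Both sides are continuous in \<open>x\<close> and agree on the dense orbit of \<eta>,
  and the odometer is Hausdorff.\<close>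

lemma factor_F_rotation:
  assumes "x \<in> orbit_closure \<eta>"
  shows "\<pi> (F x) = \<pi> x \<otimes>\<^bsub>G\<^esub> \<pi> (F \<eta>)"
proof -
  let ?X = "orbit_closure \<eta>"
  have y: "\<pi> (F \<eta>) \<in> carrier G"
    by (intro factor_closed F_closed base_in_orbit_closure)
  have orb: "\<pi> (F (translate k \<eta>)) = \<pi> (translate k \<eta>) \<otimes>\<^bsub>G\<^esub> \<pi> (F \<eta>)" for k
  proof -
    have "\<pi> (F (translate k \<eta>)) = \<pi> (F \<eta>) \<otimes>\<^bsub>G\<^esub> \<Delta> p k"
      using orbit_Delta[of "\<lambda>k. \<pi> (F (translate k \<eta>))" k]
      by (simp add: factor_closed F_closed translate_in_orbit_closure translate_add_one F_shift
          factor_shift)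
    then show ?thesis
      using y by (simp add: factor_translate_base G.m_comm)
  qed
  have lhs: "continuous_map (top_of_set ?X) T (\<pi> \<circ> F)"
    by (rule continuous_map_compose[OF _ continuous_factor])
      (use continuous_on_F F_closed in auto)
  have rhs: "continuous_map (top_of_set ?X) T ((\<lambda>g. g \<otimes>\<^bsub>G\<^esub> \<pi> (F \<eta>)) \<circ> \<pi>)"
    by (rule continuous_map_compose[OF continuous_factor continuous_map_translation[OF y]])
  have "x \<in> top_of_set ?X closure_of range (\<lambda>k. translate k \<eta>)"
    using assms translate_in_orbit_closure
    by (auto simp: closure_of_subtopology orbit_closure_eq Int_absorb1 image_subset_iff)
  then have "(\<pi> \<circ> F) x = ((\<lambda>g. g \<otimes>\<^bsub>G\<^esub> \<pi> (F \<eta>)) \<circ> \<pi>) x"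
    by (rule forall_in_closure_of_eq[OF _ Hausdorff_odometer lhs rhs]) (use orb in auto)
  then show ?thesis by simp
qed

text \<open>Uniqueness follows by evaluating at \<eta>, whose image is the identity.\<close>

lemma y_eq: "y = \<pi> (F \<eta>)"
  unfolding y_of_def
proof (rule the_equality)
  show "\<pi> (F \<eta>) \<in> carrier G \<and> (\<forall>x\<in>orbit_closure \<eta>. \<pi> (F x) = \<pi> x \<otimes>\<^bsub>G\<^esub> \<pi> (F \<eta>))"
    using factor_F_rotation factor_closed F_closed base_in_orbit_closure by blast
  fix z assume "z \<in> carrier G \<and> (\<forall>x\<in>orbit_closure \<eta>. \<pi> (F x) = \<pi> x \<otimes>\<^bsub>G\<^esub> z)"
  then show "z = \<pi> (F \<eta>)"
    using base_in_orbit_closure by (simp add: factor_base Delta_0)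
qed

lemma y_closed: "y \<in> carrier G"
  unfolding y_eq by (intro factor_closed F_closed base_in_orbit_closure)

lemma factor_F: "x \<in> orbit_closure \<eta> \<Longrightarrow> \<pi> (F x) = \<pi> x \<otimes>\<^bsub>G\<^esub> y"
  using factor_F_rotation by (simp add: y_eq)

text \<open>Injectivity of \<open>F\<close> separates the images of points that differ at \<open>0\<close>; by compactness
  they already differ in a bounded window.\<close>

lemma ex_finite_forward:
  "\<exists>L. finite L \<and> (\<forall>g\<in>bdW p \<eta>. \<exists>l\<in>L. g \<otimes>\<^bsub>G\<^esub> (y \<otimes>\<^bsub>G\<^esub> inv\<^bsub>G\<^esub> \<Delta> p l) \<in> bdW p \<eta>)"
proof -
  let ?X = "\<lambda>i. {x \<in> orbit_closure \<eta>. x 0 = i}"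
  \<comment> \<open>Pairs told apart at position \<open>s\<close>; by injectivity these open sets
    cover the compact set of image pairs.\<close>
  let ?O = "\<lambda>s :: int. {u :: (int \<Rightarrow> bool) \<times> (int \<Rightarrow> bool). fst u s \<noteq> snd u s}"
  have comp: "compact (F ` ?X True \<times> F ` ?X False)"
    by (intro compact_Times compact_continuous_image compact_orbit_closure_coordinate
        continuous_on_subset[OF continuous_on_F]) auto
  have op: "open (?O s)" for s
  proof -
    have "?O s = {x. x s = True} \<times> {x. x s = False} \<union> {x. x s = False} \<times> {x. x s = True}"
      by auto
    then show ?thesis
      by (simp only: open_Un open_Times open_coordinate)
  qed
  have "F ` ?X True \<times> F ` ?X False \<subseteq> (\<Union>s\<in>UNIV. ?O s)"
  proof clarify
    fix x z assume xz: "x \<in> orbit_closure \<eta>" "z \<in> orbit_closure \<eta>" "x 0 = True" "z 0 = False"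
    then have "F x \<noteq> F z"
      using inj_on_F by (metis inj_onD)
    then show "(F x, F z) \<in> (\<Union>s\<in>UNIV. ?O s)"
      by (auto simp: fun_eq_iff)
  qed
  from compactE_image[OF comp op this]
  obtain L where L: "finite L" "F ` ?X True \<times> F ` ?X False \<subseteq> (\<Union>s\<in>L. ?O s)"
    by this
  \<comment> \<open>A difference at position s moves g by y + \<Delta>(s), which is b_l for l = -s;
    hence the negated index set.\<close>
  have "\<exists>l\<in>uminus ` L. g \<otimes>\<^bsub>G\<^esub> (y \<otimes>\<^bsub>G\<^esub> inv\<^bsub>G\<^esub> \<Delta> p l) \<in> bdW p \<eta>" if g: "g \<in> bdW p \<eta>" for g
  proof -
    obtain x z where "x \<in> orbit_closure \<eta>" "z \<in> orbit_closure \<eta>" "\<pi> x = g" "\<pi> z = g" "x 0" "\<not> z 0"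
      using g unfolding mem_bdW_iff by blast
    then have x: "x \<in> ?X True" "\<pi> x = g" and z: "z \<in> ?X False" "\<pi> z = g"
      by simp_all
    then have "(F x, F z) \<in> F ` ?X True \<times> F ` ?X False"
      by (intro SigmaI imageI)
    then have "(F x, F z) \<in> (\<Union>s\<in>L. ?O s)"
      by (rule subsetD[OF L(2)])
    then obtain s where s: "s \<in> L" "F x s \<noteq> F z s" by auto
    have "\<pi> (F x) \<otimes>\<^bsub>G\<^esub> \<Delta> p s \<in> bdW p \<eta>"
      using x z s(2) by (intro differing_fibre_imp_bdW[of "F x" "F z"]) (auto simp: F_closed factor_F)
    then have "g \<otimes>\<^bsub>G\<^esub> (y \<otimes>\<^bsub>G\<^esub> \<Delta> p s) \<in> bdW p \<eta>"
      using x g bdW_subset y_closed by (auto simp: factor_F G.m_assoc)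
    moreover have "\<Delta> p s = inv\<^bsub>G\<^esub> \<Delta> p (- s)"
      by (simp add: Delta_minus)
    ultimately show ?thesis
      using s(1) by auto
  qed
  then show ?thesis
    using L(1) by (intro exI[of _ "uminus ` L"]) simp
qed

text \<open>Lift a pair over \<open>g\<close> differing at 0 through \<open>F\<close>. The lifts
  share the fibre over g - y and, by the code, differ at some j in the window, so g - y +
  \<Delta>(j) is in the boundary; this is g - b_j.\<close>

lemma block_code_backward:
  assumes "described_by_block_code (orbit_closure \<eta>) F m c" "g \<in> bdW p \<eta>"
  shows "\<exists>j\<in>{- int m..int m}. g \<otimes>\<^bsub>G\<^esub> inv\<^bsub>G\<^esub> (y \<otimes>\<^bsub>G\<^esub> inv\<^bsub>G\<^esub> \<Delta> p j) \<in> bdW p \<eta>"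
proof -
  obtain x' z' where *: "x' \<in> orbit_closure \<eta>" "z' \<in> orbit_closure \<eta>" "\<pi> x' = g" "\<pi> z' = g" "x' 0" "\<not> z' 0"
    using assms(2) unfolding mem_bdW_iff by blast
  then obtain x z where x: "x \<in> orbit_closure \<eta>" "x' = F x" and z: "z \<in> orbit_closure \<eta>" "z' = F z"
    using F_surj by (metis imageE)
  have code: "F w 0 = c (\<lambda>j\<in>{- int m..int m}. w j)" if "w \<in> orbit_closure \<eta>" for w
    using assms(1) that by (simp add: described_by_block_code_def)
  have "(\<lambda>j\<in>{- int m..int m}. x j) \<noteq> (\<lambda>j\<in>{- int m..int m}. z j)"
    using code[OF x(1)] code[OF z(1)] * x(2) z(2) by metis
  then obtain j where j: "j \<in> {- int m..int m}" "x j \<noteq> z j"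
    using restrict_ext[of "{- int m..int m}" x z] by blast
  have g: "g = \<pi> x \<otimes>\<^bsub>G\<^esub> y" "g = \<pi> z \<otimes>\<^bsub>G\<^esub> y"
    using * x z factor_F by auto
  then have "\<pi> x = \<pi> z"
    using G.right_cancel[OF y_closed] factor_closed x z by metis
  then have "\<pi> x \<otimes>\<^bsub>G\<^esub> \<Delta> p j \<in> bdW p \<eta>"
    by (rule differing_fibre_imp_bdW[OF x(1) z(1) _ j(2)])
  moreover have "g \<otimes>\<^bsub>G\<^esub> inv\<^bsub>G\<^esub> (y \<otimes>\<^bsub>G\<^esub> inv\<^bsub>G\<^esub> \<Delta> p j) = \<pi> x \<otimes>\<^bsub>G\<^esub> \<Delta> p j"
  proof -
    have "y \<otimes>\<^bsub>G\<^esub> (inv\<^bsub>G\<^esub> y \<otimes>\<^bsub>G\<^esub> \<Delta> p j) = \<Delta> p j"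
      using y_closed by (simp flip: G.m_assoc)
    then show ?thesis
      unfolding g(1) using y_closed factor_closed[OF x(1)] by (simp add: G.inv_mult G.m_assoc)
  qed
  ultimately show ?thesis
    using j(1) by metis
qed

end

theorem proposition2p16:
  fixes \<eta> :: "int \<Rightarrow> bool" and p :: "nat \<Rightarrow> nat"
    and \<pi> :: "(int \<Rightarrow> bool) \<Rightarrow> (nat \<Rightarrow> int)"
    and F :: "(int \<Rightarrow> bool) \<Rightarrow> (int \<Rightarrow> bool)"
    and m :: nat and c :: "(int \<Rightarrow> bool) \<Rightarrow> bool"
  assumes "nonperiodic_toeplitz \<eta> p"
    and "maximal_equicontinuous_factor (top_of_set (orbit_closure \<eta>)) shift
           (odometer_top p) (odometer_map p) \<pi>"
    and "\<pi> \<eta> = \<Delta> p 0"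
    and "\<And>k \<beta>. k \<noteq> 0 \<Longrightarrow> \<beta> \<in> carrier (odometer p) \<Longrightarrow>
           nowhere_dense_in (bdW_top p \<eta>)
             (bdW p \<eta> \<inter> (bdW p \<eta> #>\<^bsub>odometer p\<^esub> inv\<^bsub>odometer p\<^esub> \<beta>) \<inter>
              (bdW p \<eta> #>\<^bsub>odometer p\<^esub>
                 (inv\<^bsub>odometer p\<^esub> (\<beta> \<otimes>\<^bsub>odometer p\<^esub> \<beta>) \<otimes>\<^bsub>odometer p\<^esub>
                  inv\<^bsub>odometer p\<^esub> \<Delta> p k)))"
    and "automorphism (orbit_closure \<eta>) F"
    and "described_by_block_code (orbit_closure \<eta>) F m c"
  shows "(\<forall>k\<in>K p \<eta> (y_of p \<eta> \<pi> F).
            Vk' p \<eta> (y_of p \<eta> \<pi> F) k #>\<^bsub>odometer p\<^esub>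
              (y_of p \<eta> \<pi> F \<otimes>\<^bsub>odometer p\<^esub> inv\<^bsub>odometer p\<^esub> \<Delta> p k)
            \<subseteq> Vk' p \<eta> (y_of p \<eta> \<pi> F) k) \<and>
         K p \<eta> (y_of p \<eta> \<pi> F) \<subseteq> {- int m..int m} \<and>
         pairwise (\<lambda>j k. disjnt (bdW_top p \<eta> interior_of Vk' p \<eta> (y_of p \<eta> \<pi> F) j)
                                (bdW_top p \<eta> interior_of Vk' p \<eta> (y_of p \<eta> \<pi> F) k))
           (K p \<eta> (y_of p \<eta> \<pi> F))"
proof -
  interpret P: period_structure p
    using assms(1) by unfold_locales (auto simp: nonperiodic_toeplitz_def)
  have factor: "factor_map (top_of_set (orbit_closure \<eta>)) shift (odometer_top p) (odometer_map p) \<pi>"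
    using assms(2) by (simp add: maximal_equicontinuous_factor_def)
  interpret A: toeplitz_automorphism p \<eta> \<pi> F
    using assms(1,3,5) factor
    by unfold_locales (auto simp: nonperiodic_toeplitz_def factor_map_def odometer_map_def)
  have "closedin (odometer_top p) (bdW p \<eta>)"
    by (simp add: bdW_def closedin_frontier_of)
  then interpret S: overlap_setup "odometer p" "odometer_top p" "bdW p \<eta>" "\<Delta> p" "y_of p \<eta> \<pi> F"
    using assms(4)[unfolded bdW_top_def]
    by unfold_locales (simp_all add: P.topspace_odometer_top P.continuous_map_translation
        P.closed_translation_invariant_inv P.Delta_diff A.y_closed A.ex_finite_forward)
  have Vk: "Vk p \<eta> (y_of p \<eta> \<pi> F) k = S.VV k" for k
    by (simp add: Vk_def S.VV_def)
  have Vk': "Vk' p \<eta> (y_of p \<eta> \<pi> F) k = S.VV' k" for k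
    by (simp add: Vk'_def S.VV'_def Vk bdW_top_def)
  \<comment> \<open>The backward lemma is applied with the coding window as the finite set
    \<open>J\<close>.\<close>
  have "k \<in> {- int m..int m}" if "k \<in> K p \<eta> (y_of p \<eta> \<pi> F)" for k
    using that A.block_code_backward[OF assms(6)]
    by (intro S.interior_VV_nonempty_imp_mem) (auto simp: K_def Vk bdW_top_def S.b_def)
  then show ?thesis
    using S.VV'_coset_subset S.disjnt_interior_VV'
    by (auto simp: Vk' bdW_top_def S.b_def pairwise_def)
qed

end
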